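(* Let $h_1,h_2$ be non-negative functions defined on $J\subseteq\mathbb{R}$ such that $h_2(t)\le h_1(t)$ for all $t\in(0,1)$. Let $m\in[0,1]$, $b>0$ and $f:[0,b]\to\mathbb{R}$. If $f$ is $(h_2-m)$-convex, then $f$ is $(h_1-m)$-convex.
   Context: Let $h:J\subseteq\mathbb{R}\to\mathbb{R}$ be a non-negative function, where $J$ is an interval containing $(0,1)$, and let $m\in[0,1]$. A function $f:[0,b]\to\mathbb{R}$ is called $(h-m)$-convex if $f$ is non-negative and for all $x,y\in[0,b]$ and all $\alpha\in(0,1)$, $$f(\alpha x+m(1-\alpha)y)\le h(\alpha)f(x)+m\,h(1-\alpha)f(y).$$ *)

theory Defs
  imports "HOL-Analysis.Analysis"
begin

text \<open>
  A function \<open>f : [0,b] \<rightarrow> \<real>\<close> is a total function of which only the values on \<open>{0..b}\<close> matter.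
  Likewise \<open>h\<close>, whose domain is an interval \<open>J \<supseteq> (0,1)\<close>, is only evaluated at points of
  \<open>(0,1)\<close>, so the definition does not depend on \<open>J\<close>.  For \<open>m \<in> [0,1]\<close> the argument of \<open>f\<close> on
  the left-hand side lies in \<open>{0..b}\<close>.
\<close>

definition hm_convex :: "(real \<Rightarrow> real) \<Rightarrow> real \<Rightarrow> real \<Rightarrow> (real \<Rightarrow> real) \<Rightarrow> bool" where
  "hm_convex h m b f \<longleftrightarrow>
     (\<forall>x\<in>{0..b}. 0 \<le> f x) \<and>
     (\<forall>x\<in>{0..b}. \<forall>y\<in>{0..b}. \<forall>\<alpha>\<in>{0<..<1}.
        f (\<alpha> * x + m * (1 - \<alpha>) * y) \<le> h \<alpha> * f x + m * h (1 - \<alpha>) * f y)"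

end

theory Submission
  imports Defs
begin

text \<open>
  The right-hand side of the convexity inequality is linear in the values of \<open>h\<close>, with
  coefficients \<open>f x\<close> and \<open>m * f y\<close>.  Both are non-negative, because non-negativity of \<open>f\<close> is part
  of convexity and \<open>m \<ge> 0\<close>, so enlarging \<open>h\<close> only weakens the inequality.
\<close>

theorem proposition1:
  fixes h1 h2 f :: "real \<Rightarrow> real" and J :: "real set" and m b :: real
  assumes "is_interval J" and "{0<..<1} \<subseteq> J"
    and "\<forall>t\<in>J. 0 \<le> h1 t" and "\<forall>t\<in>J. 0 \<le> h2 t"
    and "\<forall>t\<in>{0<..<1}. h2 t \<le> h1 t"
    and "m \<in> {0..1}" and "b > 0"
    and "hm_convex h2 m b f"
  shows "hm_convex h1 m b f"
  unfolding hm_convex_def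
proof (intro conjI ballI)
  fix x assume "x \<in> {0..b}"
  then show "0 \<le> f x"
    using assms(8) by (simp add: hm_convex_def)
next
  fix x y \<alpha> :: real
  assume x: "x \<in> {0..b}" and y: "y \<in> {0..b}" and \<alpha>: "\<alpha> \<in> {0<..<1}"
  have nonneg: "0 \<le> f x" "0 \<le> f y" "0 \<le> m"
    using assms(6,8) x y by (auto simp: hm_convex_def)
  have le: "h2 \<alpha> \<le> h1 \<alpha>" "h2 (1 - \<alpha>) \<le> h1 (1 - \<alpha>)"
    using assms(5) \<alpha> by auto
  have "f (\<alpha> * x + m * (1 - \<alpha>) * y) \<le> h2 \<alpha> * f x + m * h2 (1 - \<alpha>) * f y"
    using assms(8) x y \<alpha> by (simp add: hm_convex_def)
  also have "\<dots> \<le> h1 \<alpha> * f x + m * h1 (1 - \<alpha>) * f y"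
    by (intro add_mono mult_right_mono mult_left_mono le nonneg)
  finally show "f (\<alpha> * x + m * (1 - \<alpha>) * y) \<le> h1 \<alpha> * f x + m * h1 (1 - \<alpha>) * f y" .
qed

end
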